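(* Let $d\ge1$, let $p\in(0,1/2)$, let $C$ be a copula on $[0,1]^d$, let $\lambda^{(p)}(C)=(\lambda^{(p)}_{J,\tau}(C))$ be the complete finite-threshold signed tail family induced by $C$ at scale $p$, and let $w^{(p)}$ be the unique coefficient system recovered from $\lambda^{(p)}(C)$ by triangular inversion. Then for every $(I,\sigma)\in\mathcal G_d$, $$w^{(p)}_{I,\sigma}=\frac{q^{(p)}_{a(I,\sigma)}}{p},$$ where $a(I,\sigma)\in\{\mathrm L,\mathrm M,\mathrm U\}^d$ is the unique ternary state with $a_i=\sigma_i$ for $i\in I$ and $a_i=\mathrm M$ for $i\notin I$. Consequently, $w^{(p)}_{I,\sigma}\ge0$ for all $(I,\sigma)\in\mathcal G_d$; $\lambda^{(p)}_{\{i\},\mathrm L}(C)=\lambda^{(p)}_{\{i\},\mathrm U}(C)=1$ for $i=1,\dots,d$; and $$p\sum_{(I,\sigma)\in\mathcal G_d}w^{(p)}_{I,\sigma}=\sum_{a\ne\mathrm M^d}q_a^{(p)}\le1.$$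
   Context: $[d]=\{1,\dots,d\}$; $\mathcal G_d=\{(I,\sigma):\emptyset\ne I\subseteq[d],\ \sigma\in\{\mathrm L,\mathrm U\}^I\}$, where $\{\mathrm L,\mathrm U\}^I$ is the set of functions $I\to\{\mathrm L,\mathrm U\}$. Let $L_p=[0,p]$, $M_p=[p,1-p]$, $U_p=[1-p,1]$. For $U\sim C$ and $a\in\{\mathrm L,\mathrm M,\mathrm U\}^d$, let $q_a^{(p)}=\Pr(U\in B_a^{(p)})$, where $B_a^{(p)}$ is the product of the intervals $L_p$, $M_p$, $U_p$ chosen in coordinate $i$ according to $a_i=\mathrm L,\mathrm M,\mathrm U$ (a partition of $[0,1]^d$ modulo null sets). $\mathrm M^d$ denotes the state $(\mathrm M,\dots,\mathrm M)$. For $(J,\tau)\in\mathcal G_d$, $\lambda^{(p)}_{J,\tau}(C)=\frac1p\sum_{a\in\{\mathrm L,\mathrm M,\mathrm U\}^d:\,a|_J=\tau}q_a^{(p)}$. Triangular inversion. From a real family $\lambda=(\lambda_{J,\tau})_{(J,\tau)\in\mathcal G_d}$ the coefficient system $w=(w_{I,\sigma})_{(I,\sigma)\in\mathcal G_d}$ is recovered recursively, by descending $|I|$ from $d$ to $1$, by $w_{I,\sigma}=\lambda_{I,\sigma}-\sum_{K\supsetneq I}\sum_{\rho\in\{\mathrm L,\mathrm U\}^K:\,\rho|_I=\sigma}w_{K,\rho}$. *)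

theory Defs
  imports "HOL-Probability.Probability"
begin

text \<open>
  The index set $[d]$ is \<open>{1..d}\<close>. Points of $[0,1]^d$, ternary states and sign patterns
  are extensional functions (\<open>\<rightarrow>\<^sub>E\<close>), so that they correspond one-to-one to
  functions on their index set.
\<close>

text \<open>
  The analytic definition: a copula is grounded, has uniform one-dimensional margins, and gives
  nonnegative volume to every box contained in the cube (the sum over \<open>S\<close> is the
  \<open>C\<close>-volume of the box with corners \<open>x\<close>, \<open>y\<close>;
  \<open>S\<close> collects the coordinates in which a vertex takes its lower value). Values of
  \<open>C\<close> outside the cube are irrelevant.
\<close>

definition unit_cube :: "nat \<Rightarrow> (nat \<Rightarrow> real) set" where
  "unit_cube d = {1..d} \<rightarrow>\<^sub>E {0..1}"

definition copula :: "nat \<Rightarrow> ((nat \<Rightarrow> real) \<Rightarrow> real) \<Rightarrow> bool" where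
  "copula d C \<longleftrightarrow>
     (\<forall>u\<in>unit_cube d. (\<exists>i\<in>{1..d}. u i = 0) \<longrightarrow> C u = 0) \<and>
     (\<forall>i\<in>{1..d}. \<forall>t\<in>{0..1}. C (\<lambda>j\<in>{1..d}. if j = i then t else 1) = t) \<and>
     (\<forall>x\<in>unit_cube d. \<forall>y\<in>unit_cube d. (\<forall>i\<in>{1..d}. x i \<le> y i) \<longrightarrow>
        0 \<le> (\<Sum>S\<in>Pow {1..d}. (- 1) ^ card S * C (\<lambda>i\<in>{1..d}. if i \<in> S then x i else y i)))"

text \<open>
  \<open>U \<sim> C\<close>: the random vector \<open>U\<close> on the probability space
  \<open>\<Omega>\<close> has joint distribution function \<open>C\<close> on the cube. For a copula
  \<open>C\<close> this forces \<open>U\<close> to lie in the cube almost surely, hence determines the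
  law of \<open>U\<close>.
\<close>

definition has_copula_law ::
  "'o measure \<Rightarrow> nat \<Rightarrow> ('o \<Rightarrow> nat \<Rightarrow> real) \<Rightarrow> ((nat \<Rightarrow> real) \<Rightarrow> real) \<Rightarrow> bool" where
  "has_copula_law \<Omega> d U C \<longleftrightarrow>
     prob_space \<Omega> \<and>
     U \<in> \<Omega> \<rightarrow>\<^sub>M (\<Pi>\<^sub>M i\<in>{1..d}. borel) \<and>
     (\<forall>u\<in>unit_cube d. \<P>(\<omega> in \<Omega>. \<forall>i\<in>{1..d}. U \<omega> i \<le> u i) = C u)"

datatype level = Low | Mid | Up

fun level_interval :: "real \<Rightarrow> level \<Rightarrow> real set" where
  "level_interval p Low = {0..p}"
| "level_interval p Mid = {p..1 - p}"
| "level_interval p Up = {1 - p..1}"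

definition states :: "nat \<Rightarrow> (nat \<Rightarrow> level) set" where
  "states d = {1..d} \<rightarrow>\<^sub>E {Low, Mid, Up}"

definition mid_state :: "nat \<Rightarrow> nat \<Rightarrow> level" where
  "mid_state d = (\<lambda>i\<in>{1..d}. Mid)"

definition signs :: "nat set \<Rightarrow> (nat \<Rightarrow> level) set" where
  "signs I = I \<rightarrow>\<^sub>E {Low, Up}"

definition sign_index :: "nat \<Rightarrow> (nat set \<times> (nat \<Rightarrow> level)) set" where
  "sign_index d = (SIGMA I:{I. I \<noteq> {} \<and> I \<subseteq> {1..d}}. signs I)"

definition state_of :: "nat \<Rightarrow> nat set \<Rightarrow> (nat \<Rightarrow> level) \<Rightarrow> nat \<Rightarrow> level" where
  "state_of d I \<sigma> = (\<lambda>i\<in>{1..d}. if i \<in> I then \<sigma> i else Mid)"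

definition state_box :: "nat \<Rightarrow> real \<Rightarrow> (nat \<Rightarrow> level) \<Rightarrow> (nat \<Rightarrow> real) set" where
  "state_box d p a = (\<Pi>\<^sub>E i\<in>{1..d}. level_interval p (a i))"

definition state_prob ::
  "'o measure \<Rightarrow> ('o \<Rightarrow> nat \<Rightarrow> real) \<Rightarrow> nat \<Rightarrow> real \<Rightarrow> (nat \<Rightarrow> level) \<Rightarrow> real" where
  "state_prob \<Omega> U d p a = \<P>(\<omega> in \<Omega>. U \<omega> \<in> state_box d p a)"

definition tail_family ::
  "'o measure \<Rightarrow> ('o \<Rightarrow> nat \<Rightarrow> real) \<Rightarrow> nat \<Rightarrow> real \<Rightarrow> nat set \<Rightarrow> (nat \<Rightarrow> level) \<Rightarrow> real" where
  "tail_family \<Omega> U d p J \<tau> =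
     1 / p * (\<Sum>a | a \<in> states d \<and> restrict a J = \<tau>. state_prob \<Omega> U d p a)"

function triangular_inversion ::
  "nat \<Rightarrow> (nat set \<Rightarrow> (nat \<Rightarrow> level) \<Rightarrow> real) \<Rightarrow> nat set \<Rightarrow> (nat \<Rightarrow> level) \<Rightarrow> real" where
  "triangular_inversion d lam I \<sigma> =
     lam I \<sigma> -
     (\<Sum>K | I \<subset> K \<and> K \<subseteq> {1..d}.
        \<Sum>\<rho> | \<rho> \<in> signs K \<and> restrict \<rho> I = \<sigma>. triangular_inversion d lam K \<rho>)"
  by auto
termination
proof (relation "Wellfounded.measure (\<lambda>(d, lam, I, \<sigma>). d - card I)", goal_cases)
  case 1
  show ?case by simp
next
  case (2 d lam I \<sigma> K \<rho>)
  then have sub: "I \<subset> K" "K \<subseteq> {1..d}" by auto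
  then have "finite K" by (meson finite_atLeastAtMost finite_subset)
  with sub have "card I < card K" by (simp add: psubset_card_mono)
  moreover have "card K \<le> d" using card_mono[OF _ sub(2)] by simp
  ultimately show ?case by simp
qed

text \<open>The recursion equation loops as a rewrite rule.\<close>
declare triangular_inversion.simps [simp del]

end

theory Submission
  imports Defs
begin

text \<open>
  The proof separates into a combinatorial and a probabilistic half.

  A ternary state \<open>a\<close> is the same thing as its support \<open>K\<close>, the coordinates where it is
  not \<open>Mid\<close>, together with the sign pattern it shows there. Under this bijection the states
  whose restriction to \<open>I\<close> is a given sign pattern \<open>\<sigma>\<close> are the pairs \<open>(K, \<rho>)\<close> with
  \<open>K \<supseteq> I\<close> and \<open>\<rho>\<close> extending \<open>\<sigma>\<close> (\<open>sum_states_extending\<close>), which is exactly the index set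
  of the triangular recursion, plus its diagonal term. So for any weights \<open>f\<close> on states, the family
  of sums of \<open>f\<close> over such states is inverted to \<open>f\<close> itself
  (\<open>triangular_inversion_of_state_sums\<close>). Applied to \<open>f = q / p\<close>, this is the formula for
  \<open>w\<close>, and nonnegativity is immediate. Summing it over all signed supports counts every state
  except the one that is \<open>Mid\<close> throughout (\<open>sum_sign_index\<close>), which is the total mass identity.

  Probability is needed only for the remaining two claims. The margins of the copula are uniform,
  hence atomless, so the overlapping box faces are null sets and almost every point lies in exactly
  one box. Sums of box probabilities are therefore probabilities of unions: the states with
  \<open>a i = Low\<close> exhaust the event \<open>U i \<le> p\<close>, those with \<open>a i = Up\<close> exhaust
  \<open>U i > 1 - p\<close>, and both events have probability \<open>p\<close>; and no such sum exceeds 1.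
\<close>

section \<open>States and signed supports\<close>

lemma finite_states [simp]: "finite (states d)"
  unfolding states_def by (intro finite_PiE) auto

lemma finite_signs: "K \<subseteq> {1..d} \<Longrightarrow> finite (signs K)"
  unfolding signs_def by (intro finite_PiE) (auto intro: finite_subset)

lemma state_of_in_states: "\<rho> \<in> signs K \<Longrightarrow> state_of d K \<rho> \<in> states d"
  unfolding states_def signs_def state_of_def by (auto simp: PiE_iff)

lemma mid_state_in_states: "mid_state d \<in> states d"
  unfolding mid_state_def states_def by auto

lemma restrict_state_of:
  assumes "I \<subseteq> K" "K \<subseteq> {1..d}"
  shows "restrict (state_of d K \<rho>) I = restrict \<rho> I"
  using assms by (auto simp: state_of_def restrict_def fun_eq_iff)

text \<open>
  Sending a state to its support and its restriction there is inverse to \<open>state_of\<close>. A state that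
  extends \<open>\<sigma>\<close> cannot be \<open>Mid\<close> anywhere on \<open>I\<close>, so its support contains \<open>I\<close>.
\<close>

lemma sum_states_extending:
  fixes f :: "(nat \<Rightarrow> level) \<Rightarrow> 'b::comm_monoid_add"
  assumes I: "I \<subseteq> {1..d}" and \<sigma>: "\<sigma> \<in> signs I"
  shows "(\<Sum>a | a \<in> states d \<and> restrict a I = \<sigma>. f a) =
    (\<Sum>K | I \<subseteq> K \<and> K \<subseteq> {1..d}. \<Sum>\<rho> | \<rho> \<in> signs K \<and> restrict \<rho> I = \<sigma>.
      f (state_of d K \<rho>))"
proof -
  define supp where "supp a = {i \<in> {1..d}. a i \<noteq> Mid}" for a :: "nat \<Rightarrow> level"
  have level: "l \<in> {Low, Mid, Up}" for l
    by (cases l) auto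
  have I_supp: "I \<subseteq> supp a" if "restrict a I = \<sigma>" for a
  proof
    fix i assume i: "i \<in> I"
    have "a i = \<sigma> i"
      using that i by (metis restrict_apply')
    moreover have "\<sigma> i \<in> {Low, Up}"
      using \<sigma> i by (auto simp: signs_def)
    ultimately show "i \<in> supp a"
      using i I by (auto simp: supp_def)
  qed
  have supp_state_of: "supp (state_of d K \<rho>) = K" if "K \<subseteq> {1..d}" "\<rho> \<in> signs K" for K \<rho>
    using that by (auto simp: supp_def state_of_def signs_def PiE_iff subset_eq)
  have restrict_supp: "restrict a (supp a) \<in> signs (supp a)" for a
    using level by (auto simp: signs_def supp_def)
  have state_of_supp: "state_of d (supp a) (restrict a (supp a)) = a" if "a \<in> states d" for a
    using that by (auto simp: state_of_def supp_def states_def fun_eq_iff PiE_def extensional_def)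
  have "(\<Sum>a | a \<in> states d \<and> restrict a I = \<sigma>. f a) =
    (\<Sum>(K, \<rho>) \<in> (SIGMA K:{K. I \<subseteq> K \<and> K \<subseteq> {1..d}}. {\<rho>. \<rho> \<in> signs K \<and> restrict \<rho> I = \<sigma>}).
      f (state_of d K \<rho>))"
  proof (rule sum.reindex_bij_witness[where
        i = "\<lambda>(K, \<rho>). state_of d K \<rho>" and j = "\<lambda>a. (supp a, restrict a (supp a))"],
      goal_cases)
    case (2 a)
    have "supp a \<subseteq> {1..d}"
      by (auto simp: supp_def)
    moreover have "restrict (restrict a (supp a)) I = \<sigma>"
      using 2 I_supp[of a] by (auto simp: Int_absorb1)
    ultimately show ?case
      using 2 I_supp[of a] restrict_supp[of a] by auto
  next
    case (3 b)
    have "restrict (state_of d K \<rho>) K = \<rho>" if "K \<subseteq> {1..d}" "\<rho> \<in> signs K" for K \<rho>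
      using that restrict_state_of[of K K d \<rho>] by (auto simp: signs_def PiE_def extensional_restrict)
    then show ?case
      using 3 by (auto simp: supp_state_of)
  qed (auto simp: state_of_supp state_of_in_states restrict_state_of)
  also have "\<dots> = (\<Sum>K | I \<subseteq> K \<and> K \<subseteq> {1..d}. \<Sum>\<rho> | \<rho> \<in> signs K \<and> restrict \<rho> I = \<sigma>.
      f (state_of d K \<rho>))"
    by (rule sum.Sigma [symmetric])
      (auto intro: finite_subset[of _ "Pow {1..d}"]
        intro!: finite_Collect_conjI finite_signs simp del: One_nat_def)
  finally show ?thesis .
qed

text \<open>
  The only pair with \<open>K = I\<close> in the sum above is \<open>(I, \<sigma>)\<close>, and the others are those that the
  recursion subtracts; larger \<open>K\<close> come earlier in the recursion, so the identity propagates down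
  from \<open>K = {1..d}\<close>.
\<close>

lemma triangular_inversion_of_state_sums:
  assumes lam: "\<And>J \<tau>. lam J \<tau> = (\<Sum>a | a \<in> states d \<and> restrict a J = \<tau>. f a)"
    and "I \<subseteq> {1..d}" "\<sigma> \<in> signs I"
  shows "triangular_inversion d lam I \<sigma> = f (state_of d I \<sigma>)"
  using assms(2,3)
proof (induction "d - card I" arbitrary: I \<sigma> rule: less_induct)
  case less
  let ?inner = "\<lambda>K. \<Sum>\<rho> | \<rho> \<in> signs K \<and> restrict \<rho> I = \<sigma>. f (state_of d K \<rho>)"
  have IH: "triangular_inversion d lam K \<rho> = f (state_of d K \<rho>)"
    if K: "I \<subset> K" "K \<subseteq> {1..d}" and \<rho>: "\<rho> \<in> signs K" for K \<rho>
  proof (rule less.hyps[OF _ K(2) \<rho>])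
    have "card I < card K" "card K \<le> d"
      using K psubset_card_mono[of K I] card_mono[of "{1..d}" K] finite_subset[of K "{1..d}"]
      by auto
    then show "d - card K < d - card I"
      by simp
  qed
  have split: "{K. I \<subseteq> K \<and> K \<subseteq> {1..d}} = insert I {K. I \<subset> K \<and> K \<subseteq> {1..d}}"
    using less.prems by auto
  have diagonal: "{\<rho>. \<rho> \<in> signs I \<and> restrict \<rho> I = \<sigma>} = {\<sigma>}"
    using less.prems by (auto simp: signs_def PiE_def extensional_restrict)
  have "lam I \<sigma> = (\<Sum>K | I \<subseteq> K \<and> K \<subseteq> {1..d}. ?inner K)"
    unfolding lam by (rule sum_states_extending[OF less.prems])
  also have "\<dots> = ?inner I + (\<Sum>K | I \<subset> K \<and> K \<subseteq> {1..d}. ?inner K)"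
    unfolding split by (subst sum.insert) (auto intro: finite_subset[of _ "Pow {1..d}"])
  also have "?inner I = f (state_of d I \<sigma>)"
    by (simp add: diagonal)
  also have "(\<Sum>K | I \<subset> K \<and> K \<subseteq> {1..d}. ?inner K) =
      (\<Sum>K | I \<subset> K \<and> K \<subseteq> {1..d}.
        \<Sum>\<rho> | \<rho> \<in> signs K \<and> restrict \<rho> I = \<sigma>. triangular_inversion d lam K \<rho>)"
    by (intro sum.cong refl) (auto simp: IH)
  finally show ?case
    by (subst triangular_inversion.simps) simp
qed

text \<open>
  The empty support carries only the state \<open>Mid\<close> everywhere, so removing it from the
  decomposition for \<open>I = {}\<close>, where every state qualifies, leaves the signed nonempty supports.
\<close>

lemma sum_sign_index:
  fixes f :: "(nat \<Rightarrow> level) \<Rightarrow> 'b::ab_group_add"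
  shows "(\<Sum>(I, \<sigma>) \<in> sign_index d. f (state_of d I \<sigma>)) = (\<Sum>a \<in> states d - {mid_state d}. f a)"
proof -
  let ?inner = "\<lambda>K. \<Sum>\<rho>\<in>signs K. f (state_of d K \<rho>)"
  have fin: "finite {K. K \<noteq> {} \<and> K \<subseteq> {1..d}}"
    by (auto intro: finite_subset[of _ "Pow {1..d}"])
  have split: "{K. K \<subseteq> {1..d}} = insert {} {K. K \<noteq> {} \<and> K \<subseteq> {1..d}}"
    by auto
  have empty: "?inner {} = f (mid_state d)"
    by (simp add: signs_def state_of_def mid_state_def)
  have "(\<Sum>a\<in>states d. f a) = (\<Sum>K | K \<subseteq> {1..d}. ?inner K)"
    using sum_states_extending[of "{}" d "\<lambda>_. undefined" f] by (simp add: signs_def restrict_def)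
  also have "\<dots> = f (mid_state d) + (\<Sum>K | K \<noteq> {} \<and> K \<subseteq> {1..d}. ?inner K)"
    unfolding split using fin empty by (subst sum.insert) auto
  also have "(\<Sum>K | K \<noteq> {} \<and> K \<subseteq> {1..d}. ?inner K) =
      (\<Sum>(I, \<sigma>) \<in> sign_index d. f (state_of d I \<sigma>))"
    unfolding sign_index_def using fin by (intro sum.Sigma) (auto intro: finite_signs simp del: One_nat_def)
  finally show ?thesis
    by (simp add: sum_diff1 mid_state_in_states)
qed

section \<open>Uniform margins and almost sure partition\<close>

lemma copula_law_measurable:
  assumes "has_copula_law \<Omega> d U C" "i \<in> {1..d}"
  shows "(\<lambda>\<omega>. U \<omega> i) \<in> borel_measurable \<Omega>"
proof -
  have "U \<in> \<Omega> \<rightarrow>\<^sub>M (\<Pi>\<^sub>M i\<in>{1..d}. borel)"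
    using assms(1) by (simp add: has_copula_law_def)
  then show ?thesis
    by (rule measurable_compose) (rule measurable_component_singleton[OF assms(2)])
qed

text \<open>
  The joint distribution function is known only on the cube, so the remaining coordinates can be
  bounded by 1 but not left free. Taking \<open>t = 1\<close> shows that all coordinates are at most 1 almost
  surely, after which those bounds may be dropped.
\<close>

lemma copula_margin:
  assumes C: "copula d C" and law: "has_copula_law \<Omega> d U C"
    and i: "i \<in> {1..d}" and t: "0 \<le> t" "t \<le> 1"
  shows "\<P>(\<omega> in \<Omega>. U \<omega> i \<le> t) = t"
proof -
  interpret prob_space \<Omega>
    using law by (simp add: has_copula_law_def)
  note [measurable] = copula_law_measurable[OF law]
  define u where "u s = (\<lambda>j\<in>{1..d}. if j = i then s else 1)" for s :: real
  have joint: "\<P>(\<omega> in \<Omega>. \<forall>j\<in>{1..d}. U \<omega> j \<le> u s j) = s" if "0 \<le> s" "s \<le> 1" for s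
  proof -
    have "u s \<in> unit_cube d"
      using that by (auto simp: u_def unit_cube_def)
    then have "\<P>(\<omega> in \<Omega>. \<forall>j\<in>{1..d}. U \<omega> j \<le> u s j) = C (u s)"
      using law unfolding has_copula_law_def by blast
    also have "\<dots> = s"
      using C i that unfolding copula_def u_def by auto
    finally show ?thesis .
  qed
  have "AE \<omega> in \<Omega>. \<forall>j\<in>{1..d}. U \<omega> j \<le> u 1 j"
    using joint[of 1] by (intro iffD1[OF prob_Collect_eq_1]) auto
  then have "AE \<omega> in \<Omega>. (\<forall>j\<in>{1..d}. U \<omega> j \<le> u t j) \<longleftrightarrow> U \<omega> i \<le> t"
    by eventually_elim (use i in \<open>auto simp: u_def\<close>)
  then have "\<P>(\<omega> in \<Omega>. \<forall>j\<in>{1..d}. U \<omega> j \<le> u t j) = \<P>(\<omega> in \<Omega>. U \<omega> i \<le> t)"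
    using i by (intro finite_measure_eq_AE) auto
  then show ?thesis
    using joint[OF t] by simp
qed

text \<open>A point mass at \<open>t\<close> would be a jump of the distribution function, which is continuous.\<close>

lemma copula_margin_no_atom:
  assumes C: "copula d C" and law: "has_copula_law \<Omega> d U C"
    and i: "i \<in> {1..d}" and t: "0 < t" "t \<le> 1"
  shows "AE \<omega> in \<Omega>. U \<omega> i \<noteq> t"
proof -
  interpret prob_space \<Omega>
    using law by (simp add: has_copula_law_def)
  note [measurable] = copula_law_measurable[OF law i]
  have "\<P>(\<omega> in \<Omega>. U \<omega> i = t) \<le> e" if e: "0 < e" for e
  proof -
    \<comment> \<open>The left end \<open>s\<close> of the interval must stay in the unit interval.\<close>
    define s where "s = max 0 (t - e)"
    have s: "0 \<le> s" "s < t" "t - s \<le> e"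
      using e t by (auto simp: s_def)
    have "\<P>(\<omega> in \<Omega>. U \<omega> i = t) \<le>
        prob ({\<omega> \<in> space \<Omega>. U \<omega> i \<le> t} - {\<omega> \<in> space \<Omega>. U \<omega> i \<le> s})"
      using s by (intro finite_measure_mono) auto
    also have "\<dots> = t - s"
      using s t copula_margin[OF C law i, of t] copula_margin[OF C law i, of s]
      by (subst finite_measure_Diff) auto
    finally show ?thesis
      using s by simp
  qed
  then have "\<P>(\<omega> in \<Omega>. U \<omega> i = t) \<le> 0"
    by (metis add_0 field_le_epsilon)
  then have "\<P>(\<omega> in \<Omega>. U \<omega> i = t) = 0"
    by (simp add: measure_le_0_iff)
  then show ?thesis
    by (intro iffD1[OF prob_Collect_eq_0]) auto
qed

definition level_of :: "real \<Rightarrow> real \<Rightarrow> level" where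
  "level_of p x = (if x \<le> p then Low else if x \<le> 1 - p then Mid else Up)"

text \<open>
  The three intervals cover the unit interval and meet only at the endpoints \<open>p\<close> and \<open>1 - p\<close>,
  which almost surely no coordinate hits; so the tie-breaking in \<open>level_of\<close> is harmless.
\<close>

lemma AE_level_iff:
  assumes C: "copula d C" and law: "has_copula_law \<Omega> d U C"
    and p: "0 < p" "p < 1 / 2"
  shows "AE \<omega> in \<Omega>. \<forall>i\<in>{1..d}. \<forall>l. U \<omega> i \<in> level_interval p l \<longleftrightarrow> l = level_of p (U \<omega> i)"
proof (rule AE_finite_allI)
  fix i assume i: "i \<in> {1..d}"
  interpret prob_space \<Omega>
    using law by (simp add: has_copula_law_def)
  note [measurable] = copula_law_measurable[OF law i]
  have "AE \<omega> in \<Omega>. \<not> U \<omega> i \<le> 0"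
    using copula_margin[OF C law i, of 0] by (subst prob_Collect_eq_0 [symmetric]) auto
  moreover have "AE \<omega> in \<Omega>. U \<omega> i \<le> 1"
    using copula_margin[OF C law i, of 1] by (subst prob_Collect_eq_1 [symmetric]) auto
  moreover have "AE \<omega> in \<Omega>. U \<omega> i \<noteq> p" "AE \<omega> in \<Omega>. U \<omega> i \<noteq> 1 - p"
    using p by (auto intro!: copula_margin_no_atom[OF C law i])
  ultimately show "AE \<omega> in \<Omega>. \<forall>l. U \<omega> i \<in> level_interval p l \<longleftrightarrow> l = level_of p (U \<omega> i)"
  proof eventually_elim
    case (elim \<omega>)
    show ?case
    proof
      fix l show "U \<omega> i \<in> level_interval p l \<longleftrightarrow> l = level_of p (U \<omega> i)"
        using elim p by (cases l) (auto simp: level_of_def)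
    qed
  qed
qed simp

text \<open>
  The function \<open>A\<close> reads off the state of a sample point, so that the box events become, up to
  null sets, the disjoint events \<open>A \<omega> = a\<close>.
\<close>

lemma AE_state_box_iff:
  assumes C: "copula d C" and law: "has_copula_law \<Omega> d U C"
    and p: "0 < p" "p < 1 / 2"
  defines "A \<equiv> \<lambda>\<omega>. \<lambda>i\<in>{1..d}. level_of p (U \<omega> i)"
  shows "AE \<omega> in \<Omega>. \<forall>a\<in>states d. U \<omega> \<in> state_box d p a \<longleftrightarrow> a = A \<omega>"
  using AE_level_iff[OF C law p] AE_space
proof eventually_elim
  case (elim \<omega>)
  have "U \<omega> \<in> space (\<Pi>\<^sub>M i\<in>{1..d}. borel)"
    using law elim(2) unfolding has_copula_law_def by (blast dest: measurable_space)
  then have ext: "U \<omega> \<in> extensional {1..d}"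
    by (simp add: space_PiM PiE_def)
  show ?case
  proof
    fix a assume "a \<in> states d"
    then have "a \<in> extensional {1..d}"
      by (simp add: states_def PiE_def)
    moreover have "A \<omega> \<in> extensional {1..d}"
      by (simp add: A_def)
    ultimately have "a = A \<omega> \<longleftrightarrow> (\<forall>i\<in>{1..d}. a i = A \<omega> i)"
      by (auto intro: extensionalityI)
    also have "\<dots> \<longleftrightarrow> (\<forall>i\<in>{1..d}. U \<omega> i \<in> level_interval p (a i))"
      using elim(1) by (intro ball_cong) (auto simp: A_def)
    also have "\<dots> \<longleftrightarrow> U \<omega> \<in> state_box d p a"
      using ext by (auto simp: state_box_def PiE_def)
    finally show "U \<omega> \<in> state_box d p a \<longleftrightarrow> a = A \<omega>"
      by blast
  qed
qed

lemma state_box_event: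
  assumes law: "has_copula_law \<Omega> d U C"
  shows "{\<omega> \<in> space \<Omega>. U \<omega> \<in> state_box d p a} \<in> sets \<Omega>"
proof -
  have "level_interval p l \<in> sets borel" for l
    by (cases l) auto
  then have "state_box d p a \<in> sets (\<Pi>\<^sub>M i\<in>{1..d}. borel)"
    unfolding state_box_def by (intro sets_PiM_I_finite) auto
  moreover have [measurable]: "U \<in> \<Omega> \<rightarrow>\<^sub>M (\<Pi>\<^sub>M i\<in>{1..d}. borel)"
    using law by (simp add: has_copula_law_def)
  ultimately show ?thesis
    by measurable
qed

section \<open>Sums of state probabilities\<close>

text \<open>
  Almost every sample point lies in exactly one box, so the box probabilities add up to the
  probability of the union of the boxes.
\<close>

lemma sum_state_prob_le_1:
  assumes C: "copula d C" and law: "has_copula_law \<Omega> d U C"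
    and p: "0 < p" "p < 1 / 2" and T: "T \<subseteq> states d"
  shows "(\<Sum>a\<in>T. state_prob \<Omega> U d p a) \<le> 1"
proof -
  interpret prob_space \<Omega>
    using law by (simp add: has_copula_law_def)
  have fin: "finite T"
    using T finite_states by (rule finite_subset)
  define A where "A \<omega> = (\<lambda>i\<in>{1..d}. level_of p (U \<omega> i))" for \<omega>
  have "AE \<omega> in \<Omega>. \<forall>a\<in>T. U \<omega> \<in> state_box d p a \<longleftrightarrow> a = A \<omega>"
    using AE_state_box_iff[OF C law p, folded A_def] by eventually_elim (meson T subsetD)
  then have unique: "AE \<omega> in \<Omega>.
      (\<forall>a\<in>T. U \<omega> \<in> state_box d p a \<longrightarrow> (\<exists>a\<in>T. U \<omega> \<in> state_box d p a)) \<and>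
      ((\<exists>a\<in>T. U \<omega> \<in> state_box d p a) \<longrightarrow> (\<exists>!a\<in>T. U \<omega> \<in> state_box d p a))"
    by eventually_elim auto
  have union: "{\<omega> \<in> space \<Omega>. \<exists>a\<in>T. U \<omega> \<in> state_box d p a} \<in> events"
    by (rule sets.sets_Collect_finite_Ex[OF state_box_event[OF law] fin])
  have "(\<Sum>a\<in>T. state_prob \<Omega> U d p a) = \<P>(\<omega> in \<Omega>. \<exists>a\<in>T. U \<omega> \<in> state_box d p a)"
    unfolding state_prob_def by (rule prob_sum[symmetric, OF fin state_box_event[OF law] union unique])
  also have "\<dots> \<le> 1"
    by (rule prob_le_1)
  finally show ?thesis .
qed

text \<open>
  The states with level \<open>Low\<close> (\<open>Up\<close>) in coordinate \<open>i\<close> together make up the event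
  \<open>U i \<le> p\<close> (\<open>U i > 1 - p\<close>), whose probability \<open>p\<close> is cancelled by the normalisation.
\<close>

lemma tail_family_singleton:
  assumes C: "copula d C" and law: "has_copula_law \<Omega> d U C"
    and p: "0 < p" "p < 1 / 2" and i: "i \<in> {1..d}" and l: "l \<in> {Low, Up}"
  shows "tail_family \<Omega> U d p {i} (\<lambda>j\<in>{i}. l) = 1"
proof -
  interpret prob_space \<Omega>
    using law by (simp add: has_copula_law_def)
  note [measurable] = copula_law_measurable[OF law i]
  define A where "A \<omega> = (\<lambda>i\<in>{1..d}. level_of p (U \<omega> i))" for \<omega>
  define Q where "Q \<omega> = (if l = Low then U \<omega> i \<le> p else \<not> U \<omega> i \<le> 1 - p)" for \<omega>
  have Q_event: "{\<omega> \<in> space \<Omega>. Q \<omega>} \<in> events"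
    unfolding Q_def by measurable
  have Q_iff: "Q \<omega> \<longleftrightarrow> A \<omega> i = l" for \<omega>
    using l i p by (auto simp: Q_def A_def level_of_def)
  have A_states: "A \<omega> \<in> states d" for \<omega>
    by (auto simp: A_def states_def level_of_def)
  have eq: "{a. a \<in> states d \<and> restrict a {i} = (\<lambda>j\<in>{i}. l)} = {a \<in> states d. a i = l}"
    by (auto simp: restrict_def fun_eq_iff)
  have "\<P>(\<omega> in \<Omega>. Q \<omega>) = (\<Sum>a\<in>{a \<in> states d. a i = l}. state_prob \<Omega> U d p a)"
    unfolding state_prob_def
  proof (rule prob_sum[OF _ state_box_event[OF law] Q_event])
    show "AE \<omega> in \<Omega>. (\<forall>a\<in>{a \<in> states d. a i = l}. U \<omega> \<in> state_box d p a \<longrightarrow> Q \<omega>) \<and>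
        (Q \<omega> \<longrightarrow> (\<exists>!a\<in>{a \<in> states d. a i = l}. U \<omega> \<in> state_box d p a))"
      using AE_state_box_iff[OF C law p, folded A_def]
      by eventually_elim (use A_states in \<open>auto simp: Q_iff\<close>)
  qed simp
  moreover have "\<P>(\<omega> in \<Omega>. Q \<omega>) = p"
  proof (cases "l = Low")
    case True
    then show ?thesis
      using copula_margin[OF C law i, of p] p by (simp add: Q_def)
  next
    case False
    then show ?thesis
      using copula_margin[OF C law i, of "1 - p"] p prob_neg[of "\<lambda>\<omega>. U \<omega> i \<le> 1 - p"]
      by (simp add: Q_def)
  qed
  ultimately show ?thesis
    using p by (simp add: tail_family_def eq)
qed

theorem proposition14:
  fixes d :: nat and p :: real
    and C :: "(nat \<Rightarrow> real) \<Rightarrow> real"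
    and \<Omega> :: "'o measure" and U :: "'o \<Rightarrow> nat \<Rightarrow> real"
    and w :: "nat set \<Rightarrow> (nat \<Rightarrow> level) \<Rightarrow> real"
  assumes "d \<ge> 1" and "0 < p" and "p < 1 / 2"
    and "copula d C"
    and "has_copula_law \<Omega> d U C"
    and "w = triangular_inversion d (tail_family \<Omega> U d p)"
  shows "(\<forall>(I, \<sigma>) \<in> sign_index d. w I \<sigma> = state_prob \<Omega> U d p (state_of d I \<sigma>) / p)
    \<and> (\<forall>(I, \<sigma>) \<in> sign_index d. w I \<sigma> \<ge> 0)
    \<and> (\<forall>i \<in> {1..d}. tail_family \<Omega> U d p {i} (\<lambda>j\<in>{i}. Low) = 1
                   \<and> tail_family \<Omega> U d p {i} (\<lambda>j\<in>{i}. Up) = 1)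
    \<and> p * (\<Sum>(I, \<sigma>) \<in> sign_index d. w I \<sigma>)
        = (\<Sum>a \<in> states d - {mid_state d}. state_prob \<Omega> U d p a)
    \<and> (\<Sum>a \<in> states d - {mid_state d}. state_prob \<Omega> U d p a) \<le> 1"
proof (intro conjI)
  let ?q = "state_prob \<Omega> U d p"
  have "tail_family \<Omega> U d p J \<tau> = (\<Sum>a | a \<in> states d \<and> restrict a J = \<tau>. ?q a / p)" for J \<tau>
    by (simp add: tail_family_def sum_divide_distrib)
  then have w: "w I \<sigma> = ?q (state_of d I \<sigma>) / p" if "(I, \<sigma>) \<in> sign_index d" for I \<sigma>
    unfolding assms(6) using that
    by (intro triangular_inversion_of_state_sums) (auto simp: sign_index_def)
  then show "\<forall>(I, \<sigma>) \<in> sign_index d. w I \<sigma> = ?q (state_of d I \<sigma>) / p"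
    by auto
  show "\<forall>(I, \<sigma>) \<in> sign_index d. w I \<sigma> \<ge> 0"
    using w \<open>0 < p\<close> by (auto simp: state_prob_def)
  show "\<forall>i \<in> {1..d}. tail_family \<Omega> U d p {i} (\<lambda>j\<in>{i}. Low) = 1
      \<and> tail_family \<Omega> U d p {i} (\<lambda>j\<in>{i}. Up) = 1"
    using tail_family_singleton[OF assms(4,5,2,3)] by blast
  have "p * (\<Sum>(I, \<sigma>) \<in> sign_index d. w I \<sigma>) =
      (\<Sum>(I, \<sigma>) \<in> sign_index d. ?q (state_of d I \<sigma>))"
    unfolding sum_distrib_left using w \<open>0 < p\<close> by (intro sum.cong) auto
  then show "p * (\<Sum>(I, \<sigma>) \<in> sign_index d. w I \<sigma>) = (\<Sum>a \<in> states d - {mid_state d}. ?q a)"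
    by (simp add: sum_sign_index)
  show "(\<Sum>a \<in> states d - {mid_state d}. ?q a) \<le> 1"
    by (rule sum_state_prob_le_1[OF assms(4,5,2,3)]) auto
qed

end
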